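(* Let $g:\mathbb{R}\to\mathbb{R}$ be a concave function. Then the following assertions are equivalent: (i) There exists a separately convex function $f:\mathbb{R}^2\to\mathbb{R}$ such that $f(u,u)=g(u)$ for each $u\in\mathbb{R}$. (ii) The function $$x\;\mapsto\;\int_0^1\frac{g(x+t)+g(x-t)-2g(x)}{t^2}\,dt$$ is locally bounded from below (i.e. bounded from below on every bounded subset of $\mathbb{R}$).
   Context: A function $f:\mathbb{R}^d\to\mathbb{R}$ is called separately convex if it is convex on every line parallel to a coordinate axis. *)

theory Defs
  imports "HOL-Analysis.Analysis"
begin

definition sep_convex :: "(real \<Rightarrow> real \<Rightarrow> real) \<Rightarrow> bool" where
  "sep_convex f \<longleftrightarrow> (\<forall>y. convex_on UNIV (\<lambda>x. f x y)) \<and> (\<forall>x. convex_on UNIV (\<lambda>y. f x y))"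

text \<open>The integral  int_0^1 (g(x+t)+g(x-t)-2g(x))/t^2 dt  as an extended real.
  For concave g the integrand is nonpositive, so the integral is well defined in [-infinity,0];
  we compute it as minus the (nonnegative) Lebesgue integral of the negated integrand.\<close>
definition second_diff_integral :: "(real \<Rightarrow> real) \<Rightarrow> real \<Rightarrow> ereal" where
  "second_diff_integral g x =
     - enn2ereal (\<integral>\<^sup>+ t\<in>{0..1}. ennreal (- ((g (x + t) + g (x - t) - 2 * g x) / t\<^sup>2)) \<partial>lborel)"

end

theory Submission
  imports Defs
begin

text \<open>
  Write \<open>D\<^sub>a(t) = 2 g(a) - g(a + t) - g(a - t)\<close>, which is nonnegative and increasing in \<open>t \<ge> 0\<close>; condition (ii) says
  that \<open>E(a) = \<integral>\<^sub>0\<^sup>1 D\<^sub>a(t) / t\<^sup>2 dt\<close> is locally bounded.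

  If \<open>f\<close> is separately convex with trace \<open>g\<close>, then \<open>P(t) = f(a + t, a - t) + f(a - t, a + t) - 2 f(a, a)\<close> satisfies
  \<open>P(t) \<ge> 0\<close> and \<open>P(t) \<ge> 2 P(t/2) + D\<^sub>a(t)/3\<close>. Hence the integral over \<open>(t/2, t]\<close>, which is at most \<open>2 D\<^sub>a(t)/t\<close>, is
  bounded by six times the drop of \<open>P(t)/t\<close> from \<open>t\<close> to \<open>t/2\<close>; these drops telescope, so \<open>E(a) \<le> 6 P(1)\<close>, and
  \<open>P(1)\<close> is locally bounded in \<open>a\<close>.

  Conversely, suprema of separately convex functions are separately convex, so it suffices to find for each \<open>a\<close> one
  which touches \<open>g\<close> at \<open>(a, a)\<close>, lies below \<open>g\<close> on the diagonal and is bounded above at each point, uniformly for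
  \<open>a\<close> in a bounded set. Start with the tangent of \<open>g\<close> at \<open>a\<close>. Near \<open>a\<close> it has to be lowered by \<open>D\<^sub>a\<close>: superpose
  dips of all scales \<open>t \<le> 1\<close> with weights \<open>D\<^sub>a(t) / t\<^sup>2\<close>, at a cost of at most \<open>E(a) \<bar>x - y\<bar>\<close>. Far from \<open>a\<close>, use
  translates of the function which is \<open>0\<close> on a quadrant and \<open>- x y\<close> elsewhere. Finally, extensions over growing
  intervals are combined by a supremum after pushing each of them down on a box which avoids the part of the
  diagonal where it is needed.
\<close>

subsection \<open>Concave functions on the line\<close>

lemma concave_on_supergradient:
  fixes g :: "real \<Rightarrow> real"
  assumes "concave_on UNIV g"
  obtains c where "\<And>u. g u \<le> g a + c * (u - a)"
proof -
  define d where "d = Inf ((\<lambda>t. (- g a - - g t) / (a - t)) ` ({a<..} \<inter> UNIV))"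
  have "- g a + d * (u - a) \<le> - g u" for u
    using convex_le_Inf_differential[of UNIV "\<lambda>x. - g x" a u] assms
    by (simp add: concave_on_def d_def)
  then have "g u \<le> g a + (- d) * (u - a)" for u by (smt (verit) mult_minus_left)
  then show ?thesis using that by blast
qed

lemma concave_on_UNIV_continuous:
  fixes g :: "'a::euclidean_space \<Rightarrow> real"
  assumes "concave_on UNIV g"
  shows "continuous_on UNIV g"
  using convex_on_continuous[of UNIV "\<lambda>x. - g x"] assms continuous_on_minus[of UNIV "\<lambda>x. - g x"]
  by (simp add: concave_on_def)

lemma concave_on_locally_bounded:
  fixes g :: "real \<Rightarrow> real"
  assumes "concave_on UNIV g"
  obtains B where "\<And>u. \<bar>u\<bar> \<le> r \<Longrightarrow> \<bar>g u\<bar> \<le> B"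
proof -
  have "continuous_on {- r..r} g"
    using concave_on_UNIV_continuous[OF assms] continuous_on_subset by blast
  then have "bounded (g ` {- r..r})"
    by (intro compact_imp_bounded compact_continuous_image) auto
  then obtain B where "\<forall>u\<in>{- r..r}. \<bar>g u\<bar> \<le> B" by (auto simp: bounded_iff)
  then show ?thesis using that[of B] by (simp add: abs_le_iff)
qed

lemma supergradient_gap_locally_bounded:
  fixes g c :: "real \<Rightarrow> real"
  assumes g: "concave_on UNIV g" and c: "\<And>a u. g u \<le> g a + c a * (u - a)"
  obtains B where "\<And>a u. \<bar>a\<bar> \<le> r \<Longrightarrow> \<bar>u\<bar> \<le> r \<Longrightarrow> g a + c a * (u - a) - g u \<le> B"
proof -
  obtain B where B: "\<And>u. \<bar>u\<bar> \<le> r + 1 \<Longrightarrow> \<bar>g u\<bar> \<le> B"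
    using concave_on_locally_bounded[OF g, of "r + 1"] by blast
  have "g a + c a * (u - a) - g u \<le> 2 * B + 4 * B * r" if a: "\<bar>a\<bar> \<le> r" and u: "\<bar>u\<bar> \<le> r" for a u
  proof -
    have "g (a + 1) \<le> g a + c a" "g (a - 1) \<le> g a - c a" using c[of "a + 1" a] c[of "a - 1" a] by simp_all
    moreover have "\<bar>g a\<bar> \<le> B" "\<bar>g (a + 1)\<bar> \<le> B" "\<bar>g (a - 1)\<bar> \<le> B" using a by (auto intro!: B)
    ultimately have "\<bar>c a\<bar> \<le> 2 * B" by linarith
    moreover have "\<bar>u - a\<bar> \<le> 2 * r" using a u by linarith
    ultimately have "\<bar>c a\<bar> * \<bar>u - a\<bar> \<le> 2 * B * (2 * r)" by (intro mult_mono) auto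
    then have "c a * (u - a) \<le> 2 * B * (2 * r)" using abs_ge_self[of "c a * (u - a)"] by (simp add: abs_mult)
    moreover have "\<bar>g a\<bar> \<le> B" "\<bar>g u\<bar> \<le> B" using a u by (auto intro!: B)
    ultimately show ?thesis by linarith
  qed
  then show ?thesis using that by blast
qed

subsection \<open>Second differences\<close>

definition second_difference :: "(real \<Rightarrow> real) \<Rightarrow> real \<Rightarrow> real \<Rightarrow> real" where
  "second_difference g a t = 2 * g a - g (a + t) - g (a - t)"

definition second_difference_quotient :: "(real \<Rightarrow> real) \<Rightarrow> real \<Rightarrow> real \<Rightarrow> real" where
  "second_difference_quotient g a t = second_difference g a t / t\<^sup>2"

definition second_difference_energy :: "(real \<Rightarrow> real) \<Rightarrow> real \<Rightarrow> real set \<Rightarrow> ennreal" where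
  "second_difference_energy g a A = (\<integral>\<^sup>+ t\<in>A. ennreal (second_difference_quotient g a t) \<partial>lborel)"

lemma second_difference_abs: "second_difference g a \<bar>t\<bar> = second_difference g a t"
  by (simp add: second_difference_def abs_if)

lemma second_difference_nonneg:
  assumes "concave_on UNIV g"
  shows "0 \<le> second_difference g a t"
proof -
  have "(1 - 1/2) *\<^sub>R (a + t) + (1/2) *\<^sub>R (a - t) = a" by (simp add: field_simps)
  then show ?thesis
    using concave_onD[OF assms, of "1/2" "a + t" "a - t"] by (simp add: second_difference_def)
qed

lemma second_difference_mono:
  assumes g: "concave_on UNIV g" and "0 \<le> s" "s \<le> t"
  shows "second_difference g a s \<le> second_difference g a t"
proof (cases "t = 0")
  case False
  with assms have t: "t > 0" by simp
  define r where "r = s / t"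
  have r: "0 \<le> r" "r \<le> 1" "s = r * t" using assms t by (auto simp: r_def)
  have "(1 - r) * g a + r * g (a + t) \<le> g (a + s)" "(1 - r) * g a + r * g (a - t) \<le> g (a - s)"
    using concave_onD[OF g r(1,2), of a "a + t"] concave_onD[OF g r(1,2), of a "a - t"]
    by (simp_all add: r(3) algebra_simps)
  then have "second_difference g a s \<le> r * second_difference g a t"
    by (simp add: second_difference_def algebra_simps)
  also have "\<dots> \<le> 1 * second_difference g a t"
    using r second_difference_nonneg[OF g] by (intro mult_right_mono) auto
  finally show ?thesis by simp
qed (use assms in auto)

lemma second_difference_quotient_nonneg:
  "concave_on UNIV g \<Longrightarrow> 0 \<le> second_difference_quotient g a t"
  by (simp add: second_difference_quotient_def second_difference_nonneg)

lemma borel_measurable_second_difference_quotient: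
  assumes "concave_on UNIV g"
  shows "second_difference_quotient g a \<in> borel_measurable borel"
proof -
  have [measurable]: "g \<in> borel_measurable borel"
    using concave_on_UNIV_continuous[OF assms] by (rule borel_measurable_continuous_onI)
  show ?thesis
    unfolding second_difference_quotient_def[abs_def] second_difference_def by measurable
qed

lemma second_diff_integral_eq_energy: "second_diff_integral g a = - enn2ereal (second_difference_energy g a {0..1})"
proof -
  have "- ((g (a + t) + g (a - t) - 2 * g a) / t\<^sup>2) = second_difference_quotient g a t" for t
  proof -
    have "- (g (a + t) + g (a - t) - 2 * g a) = second_difference g a t" by (simp add: second_difference_def)
    then show ?thesis by (metis minus_divide_left second_difference_quotient_def)
  qed
  then show ?thesis by (simp only: second_diff_integral_def second_difference_energy_def)
qed

lemma second_diff_integral_bounded_below_iff: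
  "(\<exists>M. \<forall>a\<in>S. ereal M \<le> second_diff_integral g a) \<longleftrightarrow>
   (\<exists>M. \<forall>a\<in>S. second_difference_energy g a {0..1} \<le> ennreal M)"
proof
  assume "\<exists>M. \<forall>a\<in>S. ereal M \<le> second_diff_integral g a"
  then obtain M where M: "\<And>a. a \<in> S \<Longrightarrow> ereal M \<le> - enn2ereal (second_difference_energy g a {0..1})"
    by (auto simp: second_diff_integral_eq_energy)
  have "second_difference_energy g a {0..1} \<le> ennreal (- M)" if "a \<in> S" for a
  proof -
    have "enn2ereal (second_difference_energy g a {0..1}) \<le> ereal (- M)"
      using M[OF that] by (metis ereal_minus_le_minus ereal_uminus_uminus uminus_ereal.simps(1))
    then show ?thesis using e2ennreal_mono by fastforce
  qed
  then show "\<exists>M. \<forall>a\<in>S. second_difference_energy g a {0..1} \<le> ennreal M" by blast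
next
  assume "\<exists>M. \<forall>a\<in>S. second_difference_energy g a {0..1} \<le> ennreal M"
  then obtain M where M: "\<And>a. a \<in> S \<Longrightarrow> second_difference_energy g a {0..1} \<le> ennreal M" by blast
  have "ereal (- max 0 M) \<le> second_diff_integral g a" if "a \<in> S" for a
  proof -
    have "enn2ereal (second_difference_energy g a {0..1}) \<le> ereal (max 0 M)"
      using M[OF that] by (simp add: less_eq_ennreal.rep_eq ennreal.rep_eq zero_ereal_def flip: ereal_max)
    then show ?thesis
      by (simp add: second_diff_integral_eq_energy ereal_minus_le_minus flip: uminus_ereal.simps(1))
  qed
  then show "\<exists>M. \<forall>a\<in>S. ereal M \<le> second_diff_integral g a" by blast
qed

subsection \<open>Traces have locally bounded energy\<close>

lemma sep_convexD_fst:
  assumes "sep_convex f" "0 \<le> t" "t \<le> 1" "z = (1 - t) * x + t * x'"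
  shows "f z y \<le> (1 - t) * f x y + t * f x' y"
  using convex_onD[of UNIV "\<lambda>x. f x y" t x x'] assms by (simp add: sep_convex_def)

lemma sep_convexD_snd:
  assumes "sep_convex f" "0 \<le> t" "t \<le> 1" "z = (1 - t) * y + t * y'"
  shows "f x z \<le> (1 - t) * f x y + t * f x y'"
  using convex_onD[of UNIV "\<lambda>y. f x y" t y y'] assms by (simp add: sep_convex_def)

lemma sep_convex_bounded_above_on_box:
  assumes f: "sep_convex f"
  obtains C where "\<And>x y. \<bar>x\<bar> \<le> r \<Longrightarrow> \<bar>y\<bar> \<le> r \<Longrightarrow> f x y \<le> C"
proof
  fix x y :: real assume xy: "\<bar>x\<bar> \<le> r" "\<bar>y\<bar> \<le> r"
  have endpoints: "h u \<le> max (h (- r)) (h r)" if "convex_on UNIV h" "\<bar>u\<bar> \<le> r" for h :: "real \<Rightarrow> real" and u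
    using that(2) by (intro convex_on_le_max convex_on_subset[OF that(1)]) auto
  have "f x y \<le> max (f (- r) y) (f r y)"
    using f xy by (intro endpoints[of "\<lambda>x. f x y"]) (auto simp: sep_convex_def)
  moreover have "f z y \<le> max (f z (- r)) (f z r)" for z
    using f xy by (intro endpoints) (auto simp: sep_convex_def)
  ultimately show "f x y \<le> max (max (f (- r) (- r)) (f (- r) r)) (max (f r (- r)) (f r r))"
    by (meson max.mono order_trans)
qed

definition antidiagonal_difference :: "(real \<Rightarrow> real \<Rightarrow> real) \<Rightarrow> real \<Rightarrow> real \<Rightarrow> real" where
  "antidiagonal_difference f a t = f (a + t) (a - t) + f (a - t) (a + t) - 2 * f a a"

lemma second_difference_le_antidiagonal:
  assumes f: "sep_convex f"
  shows "second_difference (\<lambda>u. f u u) a t \<le> antidiagonal_difference f a t"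
proof -
  have "f a a \<le> (1 - 1/2) * f (a + t) a + 1/2 * f (a - t) a"
    by (rule sep_convexD_fst[OF f]) (auto simp: field_simps)
  moreover have "f (a + t) a \<le> (1 - 1/2) * f (a + t) (a + t) + 1/2 * f (a + t) (a - t)"
    by (rule sep_convexD_snd[OF f]) (auto simp: field_simps)
  moreover have "f (a - t) a \<le> (1 - 1/2) * f (a - t) (a + t) + 1/2 * f (a - t) (a - t)"
    by (rule sep_convexD_snd[OF f]) (auto simp: field_simps)
  ultimately show ?thesis
    unfolding second_difference_def antidiagonal_difference_def by simp
qed

text \<open>Extrapolate along the path \<open>(a + t, a - t)\<close>, \<open>(a + 2t, a - t)\<close>, \<open>(a + 2t, a - 2t)\<close>
  using the values on the diagonal, and along its mirror image.\<close>

lemma antidiagonal_difference_double: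
  assumes f: "sep_convex f"
  shows "2 * antidiagonal_difference f a t + 2/3 * second_difference (\<lambda>u. f u u) a t
           + 1/3 * second_difference (\<lambda>u. f u u) a (2 * t)
         \<le> antidiagonal_difference f a (2 * t)"
proof -
  have "f (a + t) (a - t) \<le> (1 - 2/3) * f (a - t) (a - t) + 2/3 * f (a + 2 * t) (a - t)"
    by (rule sep_convexD_fst[OF f]) (auto simp: field_simps)
  moreover have "f (a - t) (a + t) \<le> (1 - 2/3) * f (a + t) (a + t) + 2/3 * f (a - 2 * t) (a + t)"
    by (rule sep_convexD_fst[OF f]) (auto simp: field_simps)
  moreover have "f (a + 2 * t) (a - t) \<le> (1 - 3/4) * f (a + 2 * t) (a + 2 * t) + 3/4 * f (a + 2 * t) (a - 2 * t)"
    by (rule sep_convexD_snd[OF f]) (auto simp: field_simps)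
  moreover have "f (a - 2 * t) (a + t) \<le> (1 - 3/4) * f (a - 2 * t) (a - 2 * t) + 3/4 * f (a - 2 * t) (a + 2 * t)"
    by (rule sep_convexD_snd[OF f]) (auto simp: field_simps)
  ultimately show ?thesis
    unfolding second_difference_def antidiagonal_difference_def by (simp add: field_simps)
qed

lemma second_difference_energy_octave_le:
  assumes g: "concave_on UNIV g" and r: "0 < r"
  shows "second_difference_energy g a {r<..2 * r} \<le> ennreal (second_difference g a (2 * r) / r)"
proof -
  let ?q = "second_difference g a (2 * r) / r\<^sup>2"
  have "second_difference_energy g a {r<..2 * r} \<le> (\<integral>\<^sup>+ t\<in>{r<..2 * r}. ennreal ?q \<partial>lborel)"
    unfolding second_difference_energy_def
  proof (rule nn_integral_mono)
    fix t
    have "second_difference_quotient g a t \<le> ?q" if t: "t \<in> {r<..2 * r}"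
      unfolding second_difference_quotient_def
    proof (rule frac_le)
      show "second_difference g a t \<le> second_difference g a (2 * r)"
        using t r by (intro second_difference_mono[OF g]) auto
    qed (use t r second_difference_nonneg[OF g] in \<open>auto intro: power_mono\<close>)
    then show "ennreal (second_difference_quotient g a t) * indicator {r<..2 * r} t
        \<le> ennreal ?q * indicator {r<..2 * r} t"
      by (auto simp: indicator_def intro: ennreal_leI)
  qed
  also have "\<dots> = ennreal ?q * ennreal r"
    using r by (simp add: nn_integral_cmult_indicator)
  also have "\<dots> = ennreal (?q * r)"
    using r second_difference_nonneg[OF g] by (intro ennreal_mult[symmetric]) auto
  also have "?q * r = second_difference g a (2 * r) / r" using r by (simp add: power2_eq_square)
  finally show ?thesis .
qed

lemma second_difference_energy_split:
  assumes g: "concave_on UNIV g" and "p \<le> q" "q \<le> r"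
  shows "second_difference_energy g a {p<..r}
           = second_difference_energy g a {p<..q} + second_difference_energy g a {q<..r}"
proof -
  have [measurable]: "second_difference_quotient g a \<in> borel_measurable borel"
    by (rule borel_measurable_second_difference_quotient[OF g])
  have "{p<..r} = {p<..q} \<union> {q<..r}" using assms by auto
  then show ?thesis
    unfolding second_difference_energy_def by (simp only:) (intro nn_integral_disjoint_pair, auto)
qed

lemma second_difference_energy_unit_le:
  assumes g: "concave_on UNIV g" and bound: "\<And>n. second_difference_energy g a {(1/2) ^ n<..1} \<le> B"
  shows "second_difference_energy g a {0..1} \<le> B"
proof -
  let ?A = "\<lambda>n::nat. {(1/2) ^ n<..1} :: real set"
  let ?\<mu> = "density lborel (\<lambda>t. ennreal (second_difference_quotient g a t))"
  have [measurable]: "second_difference_quotient g a \<in> borel_measurable borel"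
    by (rule borel_measurable_second_difference_quotient[OF g])
  have incseq: "incseq ?A"
  proof (rule incseq_SucI)
    show "?A n \<subseteq> ?A (Suc n)" for n unfolding Ioc_subset_iff by simp
  qed
  have Union: "{0<..1} = (\<Union>n. ?A n)"
  proof -
    have pos: "0 < (1/2::real) ^ n" for n by simp
    show ?thesis using real_arch_pow_inv[of _ "1/2::real"] by (auto intro: less_trans[OF pos])
  qed
  have "second_difference_energy g a {0..1} = second_difference_energy g a {0<..1}"
    unfolding second_difference_energy_def
    by (intro nn_integral_cong) (auto simp: indicator_def second_difference_quotient_def)
  also have "\<dots> = emeasure ?\<mu> (\<Union>n. ?A n)"
    unfolding Union[symmetric] by (simp add: second_difference_energy_def emeasure_density)
  also have "\<dots> = (SUP n. emeasure ?\<mu> (?A n))" using incseq by (intro SUP_emeasure_incseq[symmetric]) auto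
  also have "\<dots> \<le> B"
  proof (rule SUP_least)
    show "emeasure ?\<mu> (?A n) \<le> B" for n
      using bound[of n] by (simp add: second_difference_energy_def emeasure_density)
  qed
  finally show ?thesis .
qed

lemma antidiagonal_difference_nonneg:
  assumes "sep_convex f" "concave_on UNIV (\<lambda>u. f u u)"
  shows "0 \<le> antidiagonal_difference f a t"
  using second_difference_nonneg[OF assms(2)] second_difference_le_antidiagonal[OF assms(1)] order_trans by blast

lemma second_difference_energy_octave_add_antidiagonal_le:
  assumes f: "sep_convex f" and g: "concave_on UNIV (\<lambda>u. f u u)" and r: "0 < r"
  shows "second_difference_energy (\<lambda>u. f u u) a {r<..2 * r} + ennreal (6 * antidiagonal_difference f a r / r)
           \<le> ennreal (6 * antidiagonal_difference f a (2 * r) / (2 * r))"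
proof -
  let ?D = "second_difference (\<lambda>u. f u u) a" and ?P = "antidiagonal_difference f a"
  have "second_difference_energy (\<lambda>u. f u u) a {r<..2 * r} + ennreal (6 * ?P r / r)
      \<le> ennreal (?D (2 * r) / r) + ennreal (6 * ?P r / r)"
    by (intro add_right_mono second_difference_energy_octave_le[OF g r])
  also have "\<dots> = ennreal (?D (2 * r) / r + 6 * ?P r / r)"
    using r second_difference_nonneg[OF g] antidiagonal_difference_nonneg[OF f g]
    by (intro ennreal_plus[symmetric]) auto
  also have "\<dots> \<le> ennreal (6 * ?P (2 * r) / (2 * r))"
  proof (rule ennreal_leI)
    have "?D (2 * r) + 6 * ?P r \<le> 3 * ?P (2 * r)"
      using antidiagonal_difference_double[OF f, of a r] second_difference_nonneg[OF g, of a r] by simp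
    then have "(?D (2 * r) + 6 * ?P r) / r \<le> 3 * ?P (2 * r) / r" using r by (intro divide_right_mono) auto
    then show "?D (2 * r) / r + 6 * ?P r / r \<le> 6 * ?P (2 * r) / (2 * r)" by (simp add: add_divide_distrib)
  qed
  finally show ?thesis .
qed

lemma second_difference_energy_add_antidiagonal_le:
  assumes f: "sep_convex f" and g: "concave_on UNIV (\<lambda>u. f u u)"
  shows "second_difference_energy (\<lambda>u. f u u) a {(1/2) ^ n<..1}
             + ennreal (6 * antidiagonal_difference f a ((1/2) ^ n) / (1/2) ^ n)
           \<le> ennreal (6 * antidiagonal_difference f a 1)"
proof (induction n)
  case 0
  show ?case by (simp add: second_difference_energy_def)
next
  case (Suc n)
  let ?E = "second_difference_energy (\<lambda>u. f u u) a"
  let ?P = "\<lambda>r. ennreal (6 * antidiagonal_difference f a r / r)"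
  define r :: real where "r = (1/2) ^ Suc n"
  have r: "0 < r" "2 * r = (1/2) ^ n" "2 * r \<le> 1" by (simp_all add: r_def power_le_one)
  have "?E {r<..1} + ?P r = (?E {r<..2 * r} + ?P r) + ?E {2 * r<..1}"
    using second_difference_energy_split[OF g, of r "2 * r" 1] r by (simp add: ac_simps)
  also have "\<dots> \<le> ?P (2 * r) + ?E {2 * r<..1}"
    by (intro add_right_mono second_difference_energy_octave_add_antidiagonal_le[OF f g r(1)])
  also have "\<dots> \<le> ennreal (6 * antidiagonal_difference f a 1)"
    using Suc.IH unfolding r(2) by (simp add: add.commute)
  finally show ?case by (simp only: r_def)
qed

lemma second_difference_energy_le_antidiagonal:
  assumes f: "sep_convex f" and g: "concave_on UNIV (\<lambda>u. f u u)"
  shows "second_difference_energy (\<lambda>u. f u u) a {0..1} \<le> ennreal (6 * antidiagonal_difference f a 1)"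
proof (rule second_difference_energy_unit_le[OF g])
  show "second_difference_energy (\<lambda>u. f u u) a {(1/2) ^ n<..1} \<le> ennreal (6 * antidiagonal_difference f a 1)" for n
    by (rule order_trans[OF add_increasing2 second_difference_energy_add_antidiagonal_le[OF f g, of a n]]) simp_all
qed

proposition energy_of_trace_locally_bounded:
  assumes f: "sep_convex f" and g: "concave_on UNIV (\<lambda>u. f u u)" and S: "bounded S"
  shows "\<exists>M. \<forall>a\<in>S. second_difference_energy (\<lambda>u. f u u) a {0..1} \<le> ennreal M"
proof -
  obtain r where r: "\<And>a. a \<in> S \<Longrightarrow> \<bar>a\<bar> \<le> r" using S by (auto simp: bounded_iff)
  obtain C where C: "\<And>x y. \<bar>x\<bar> \<le> r + 1 \<Longrightarrow> \<bar>y\<bar> \<le> r + 1 \<Longrightarrow> f x y \<le> C"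
    using sep_convex_bounded_above_on_box[OF f] by blast
  obtain B where B: "\<And>u. \<bar>u\<bar> \<le> r \<Longrightarrow> \<bar>f u u\<bar> \<le> B"
    using concave_on_locally_bounded[OF g] by blast
  have "second_difference_energy (\<lambda>u. f u u) a {0..1} \<le> ennreal (12 * C + 12 * B)" if "a \<in> S" for a
  proof -
    have a: "\<bar>a\<bar> \<le> r" using that by (rule r)
    have "f (a + 1) (a - 1) \<le> C" "f (a - 1) (a + 1) \<le> C" using a by (auto intro!: C)
    then have "6 * antidiagonal_difference f a 1 \<le> 12 * C + 12 * B"
      using B[OF a] by (simp add: antidiagonal_difference_def)
    then show ?thesis
      using second_difference_energy_le_antidiagonal[OF f g, of a] by (meson ennreal_leI order_trans)
  qed
  then show ?thesis by blast
qed

subsection \<open>Closure properties of convex and separately convex functions\<close>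

lemma convex_on_compose_affine:
  fixes f :: "'a::real_vector \<Rightarrow> real"
  assumes "convex_on UNIV f"
  shows "convex_on UNIV (\<lambda>x. f (\<alpha> *\<^sub>R x + b))"
proof (rule convex_onI)
  fix t :: real and x y :: 'a
  assume t: "0 < t" "t < 1"
  have "\<alpha> *\<^sub>R ((1 - t) *\<^sub>R x + t *\<^sub>R y) + b = (1 - t) *\<^sub>R (\<alpha> *\<^sub>R x + b) + t *\<^sub>R (\<alpha> *\<^sub>R y + b)"
    by (simp add: algebra_simps)
  then show "f (\<alpha> *\<^sub>R ((1 - t) *\<^sub>R x + t *\<^sub>R y) + b)
      \<le> (1 - t) * f (\<alpha> *\<^sub>R x + b) + t * f (\<alpha> *\<^sub>R y + b)"
    using convex_onD[OF assms, of t "\<alpha> *\<^sub>R x + b" "\<alpha> *\<^sub>R y + b"] t by simp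
qed simp

lemma convex_on_SUP:
  assumes convex: "\<And>i. i \<in> I \<Longrightarrow> convex_on S (F i)" and nonempty: "I \<noteq> {}"
    and bdd: "\<And>x. x \<in> S \<Longrightarrow> bdd_above ((\<lambda>i. F i x) ` I)"
  shows "convex_on S (\<lambda>x. SUP i\<in>I. F i x)"
proof (rule convex_onI)
  fix t :: real and x y assume t: "0 < t" "t < 1" and xy: "x \<in> S" "y \<in> S"
  show "(SUP i\<in>I. F i ((1 - t) *\<^sub>R x + t *\<^sub>R y)) \<le> (1 - t) * (SUP i\<in>I. F i x) + t * (SUP i\<in>I. F i y)"
  proof (rule cSUP_least[OF nonempty])
    fix i assume i: "i \<in> I"
    have "F i ((1 - t) *\<^sub>R x + t *\<^sub>R y) \<le> (1 - t) * F i x + t * F i y"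
      using t xy by (intro convex_onD[OF convex[OF i]]) auto
    also have "\<dots> \<le> (1 - t) * (SUP i\<in>I. F i x) + t * (SUP i\<in>I. F i y)"
      using t xy by (intro add_mono mult_left_mono cSUP_upper[OF i] bdd) auto
    finally show "F i ((1 - t) *\<^sub>R x + t *\<^sub>R y) \<le> (1 - t) * (SUP i\<in>I. F i x) + t * (SUP i\<in>I. F i y)" .
  qed
qed (use nonempty convex convex_on_imp_convex in blast)

lemma convex_on_max:
  assumes "convex_on S f" "convex_on S h"
  shows "convex_on S (\<lambda>x. max (f x) (h x))"
proof -
  have "convex_on S (\<lambda>x. SUP k\<in>{f, h}. k x)" using assms by (intro convex_on_SUP) auto
  then show ?thesis by (simp add: cSup_eq_Max)
qed

lemma convex_on_suminf:
  fixes F :: "nat \<Rightarrow> 'a::real_vector \<Rightarrow> real"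
  assumes convex: "\<And>n. convex_on S (F n)" and summable: "\<And>x. x \<in> S \<Longrightarrow> summable (\<lambda>n. F n x)"
  shows "convex_on S (\<lambda>x. \<Sum>n. F n x)"
proof (rule convex_onI)
  fix t :: real and x y assume t: "0 < t" "t < 1" and xy: "x \<in> S" "y \<in> S"
  have "(1 - t) *\<^sub>R x + t *\<^sub>R y \<in> S"
    using convex_on_imp_convex[OF convex] t xy by (simp add: convex_alt)
  then have "(\<Sum>n. F n ((1 - t) *\<^sub>R x + t *\<^sub>R y)) \<le> (\<Sum>n. (1 - t) * F n x + t * F n y)"
    using t xy by (intro suminf_le summable summable_add summable_mult convex_onD[OF convex]) auto
  also have "\<dots> = (1 - t) * (\<Sum>n. F n x) + t * (\<Sum>n. F n y)"
    using xy by (simp add: suminf_mult summable_mult summable flip: suminf_add)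
  finally show "(\<Sum>n. F n ((1 - t) *\<^sub>R x + t *\<^sub>R y)) \<le> (1 - t) * (\<Sum>n. F n x) + t * (\<Sum>n. F n y)" .
qed (use convex convex_on_imp_convex in blast)

lemma convex_on_set_integral:
  assumes domain: "convex S" and convex: "\<And>t. t \<in> A \<Longrightarrow> convex_on S (F t)"
    and integrable: "\<And>x. x \<in> S \<Longrightarrow> set_integrable M A (\<lambda>t. F t x)"
  shows "convex_on S (\<lambda>x. LINT t:A|M. F t x)"
proof (rule convex_onI)
  fix r :: real and x y assume r: "0 < r" "r < 1" and xy: "x \<in> S" "y \<in> S"
  have "(1 - r) *\<^sub>R x + r *\<^sub>R y \<in> S" using domain r xy by (simp add: convex_alt)
  then have "(LINT t:A|M. F t ((1 - r) *\<^sub>R x + r *\<^sub>R y)) \<le> (LINT t:A|M. (1 - r) * F t x + r * F t y)"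
    using r xy
    by (intro set_integral_mono integrable set_integral_add set_integrable_mult_right convex_onD[OF convex]) auto
  also have "\<dots> = (1 - r) * (LINT t:A|M. F t x) + r * (LINT t:A|M. F t y)"
    using xy by (simp add: integrable)
  finally show "(LINT t:A|M. F t ((1 - r) *\<^sub>R x + r *\<^sub>R y))
      \<le> (1 - r) * (LINT t:A|M. F t x) + r * (LINT t:A|M. F t y)" .
qed (rule domain)

lemma sep_convex_add: "sep_convex f \<Longrightarrow> sep_convex h \<Longrightarrow> sep_convex (\<lambda>x y. f x y + h x y)"
  by (auto simp: sep_convex_def)

lemma sep_convex_cmul: "0 \<le> c \<Longrightarrow> sep_convex f \<Longrightarrow> sep_convex (\<lambda>x y. c * f x y)"
  by (auto simp: sep_convex_def)

lemma sep_convex_max: "sep_convex f \<Longrightarrow> sep_convex h \<Longrightarrow> sep_convex (\<lambda>x y. max (f x y) (h x y))"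
  unfolding sep_convex_def by (auto intro: convex_on_max)

lemma sep_convex_affine: "sep_convex (\<lambda>x y. \<alpha> + \<beta> * x + \<gamma> * y)"
  unfolding sep_convex_def by (auto intro!: convex_onI simp: algebra_simps)

lemma sep_convex_compose_affine:
  assumes "sep_convex f"
  shows "sep_convex (\<lambda>x y. f (\<alpha> * x + b) (\<alpha> * y + b))"
  using assms convex_on_compose_affine[of "\<lambda>x. f x _"] convex_on_compose_affine[of "f _"]
  by (simp add: sep_convex_def)

lemma sep_convex_SUP:
  assumes "\<And>i. i \<in> I \<Longrightarrow> sep_convex (F i)" "I \<noteq> {}" "\<And>x y. bdd_above ((\<lambda>i. F i x y) ` I)"
  shows "sep_convex (\<lambda>x y. SUP i\<in>I. F i x y)"
  using assms unfolding sep_convex_def by (auto intro!: convex_on_SUP)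

lemma sep_convex_suminf:
  assumes "\<And>n. sep_convex (F n)" "\<And>x y. summable (\<lambda>n. F n x y)"
  shows "sep_convex (\<lambda>x y. \<Sum>n. F n x y)"
  using assms unfolding sep_convex_def by (auto intro!: convex_on_suminf)

lemma sep_convex_set_integral:
  assumes "\<And>t. t \<in> A \<Longrightarrow> sep_convex (F t)" "\<And>x y. set_integrable M A (\<lambda>t. F t x y)"
  shows "sep_convex (\<lambda>x y. LINT t:A|M. F t x y)"
  using assms unfolding sep_convex_def by (auto intro!: convex_on_set_integral)

lemma sep_convex_symmetricI:
  assumes "\<And>y. convex_on UNIV (\<lambda>x. f x y)" "\<And>x y. f x y = f y x"
  shows "sep_convex f"
proof -
  have "(\<lambda>y. f y x) = f x" for x using assms(2) by auto
  then have "convex_on UNIV (f x)" for x using assms(1)[of x] by (simp only:)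
  then show ?thesis using assms(1) by (simp add: sep_convex_def)
qed

subsection \<open>Quadrant blocks\<close>

text \<open>Its trace is \<open>- u\<^sup>2\<close> for \<open>u > 0\<close> although it vanishes on a whole quadrant, so translates of it can
  push the trace down arbitrarily far out without affecting a given bounded set.\<close>

definition quadrant_block :: "real \<Rightarrow> real \<Rightarrow> real" where
  "quadrant_block x y = (if x \<le> 0 \<and> y \<le> 0 then 0 else - (x * y))"

lemma sep_convex_quadrant_block: "sep_convex quadrant_block"
proof (rule sep_convex_symmetricI)
  fix y :: real
  have lin: "convex_on UNIV (\<lambda>x. - (x * y))" by (intro convex_onI) (simp_all add: algebra_simps)
  show "convex_on UNIV (\<lambda>x. quadrant_block x y)"
  proof (cases "y \<le> 0")
    case True
    then have "(\<lambda>x. quadrant_block x y) = (\<lambda>x. max 0 (- (x * y)))"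
      by (auto simp: quadrant_block_def fun_eq_iff max_def mult_le_0_iff zero_le_mult_iff)
    then show ?thesis using convex_on_max[OF _ lin, of "\<lambda>x. 0"] by (simp add: convex_on_const)
  next
    case False
    then show ?thesis using lin by (simp add: quadrant_block_def)
  qed
qed (simp add: quadrant_block_def)

lemma quadrant_block_diag: "quadrant_block u u = (if u \<le> 0 then 0 else - u\<^sup>2)"
  by (simp add: quadrant_block_def power2_eq_square)

lemma quadrant_block_diag_nonpos: "quadrant_block u u \<le> 0"
  by (simp add: quadrant_block_diag)

definition quadrant_series :: "(nat \<Rightarrow> real) \<Rightarrow> real \<Rightarrow> real \<Rightarrow> real" where
  "quadrant_series d x y = (\<Sum>n. d n * quadrant_block (x - n) (y - n))"

lemma summable_quadrant_series: "summable (\<lambda>n. d n * quadrant_block (x - real n) (y - real n))"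
proof (rule summable_finite)
  show "finite {..<nat \<lceil>max x y\<rceil>}" by simp
  show "d n * quadrant_block (x - real n) (y - real n) = 0" if "n \<notin> {..<nat \<lceil>max x y\<rceil>}" for n
    using that by (auto simp: quadrant_block_def not_less nat_le_iff ceiling_le_iff)
qed

lemma sep_convex_quadrant_series:
  assumes "\<And>n. 0 \<le> d n"
  shows "sep_convex (quadrant_series d)"
  unfolding quadrant_series_def
proof (intro sep_convex_suminf summable_quadrant_series sep_convex_cmul assms)
  show "sep_convex (\<lambda>x y. quadrant_block (x - real n) (y - real n))" for n
    using sep_convex_compose_affine[OF sep_convex_quadrant_block, of 1 "- real n"] by simp
qed

lemma quadrant_series_0: "quadrant_series d 0 0 = 0"
  by (simp add: quadrant_series_def quadrant_block_diag)

lemma quadrant_series_diag_le: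
  assumes "\<And>n. 0 \<le> d n"
  shows "quadrant_series d u u \<le> d n * quadrant_block (u - n) (u - n)"
proof -
  have "(\<Sum>k\<in>{n}. - (d k * quadrant_block (u - k) (u - k))) \<le> (\<Sum>k. - (d k * quadrant_block (u - k) (u - k)))"
    using assms quadrant_block_diag_nonpos
    by (intro sum_le_suminf summable_minus summable_quadrant_series) (auto simp: mult_nonneg_nonpos)
  then show ?thesis by (simp add: quadrant_series_def suminf_minus summable_quadrant_series)
qed

lemma quadrant_series_diag_nonpos:
  assumes "\<And>n. 0 \<le> d n"
  shows "quadrant_series d u u \<le> 0"
  using quadrant_series_diag_le[of d u 0, OF assms] assms[of 0] quadrant_block_diag_nonpos[of "u - 0"]
  by (simp add: mult_nonneg_nonpos order_trans)

lemma quadrant_series_diag_le_neg: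
  assumes "\<And>n. 0 \<le> d n" "1/2 \<le> u"
  obtains n where "u \<le> real n + 2" "quadrant_series d u u \<le> - d n / 4"
proof -
  define n where "n = nat \<lfloor>u - 1/2\<rfloor>"
  have n: "real n = of_int \<lfloor>u - 1/2\<rfloor>" using assms by (simp add: n_def)
  have v: "1/2 \<le> u - n" "u \<le> real n + 2" unfolding n by linarith+
  have "quadrant_series d u u \<le> d n * quadrant_block (u - n) (u - n)"
    by (rule quadrant_series_diag_le[OF assms(1)])
  also have "\<dots> = - (d n * (u - n)\<^sup>2)" using v by (simp add: quadrant_block_diag)
  also have "\<dots> \<le> - (d n * (1/2)\<^sup>2)" using v assms(1) by (intro le_imp_neg_le mult_left_mono power_mono) auto
  finally show ?thesis using v by (intro that[of n]) (simp_all add: power2_eq_square)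
qed

definition box_well :: "real \<Rightarrow> real \<Rightarrow> real \<Rightarrow> real" where
  "box_well m x y = max (quadrant_block (m - x) (m - y)) (quadrant_block (m + x) (m + y))"

lemma sep_convex_box_well: "sep_convex (box_well m)"
  using sep_convex_max[OF sep_convex_compose_affine[OF sep_convex_quadrant_block, of "-1" m]
      sep_convex_compose_affine[OF sep_convex_quadrant_block, of 1 m]]
  by (simp add: box_well_def[abs_def] add.commute)

lemma box_well_diag_nonpos: "box_well m u u \<le> 0"
  by (simp add: box_well_def quadrant_block_diag_nonpos)

lemma box_well_diag_eq_0: "m \<le> \<bar>u\<bar> \<Longrightarrow> box_well m u u = 0"
  by (auto simp: box_well_def quadrant_block_diag max_def abs_if split: if_splits)

lemma box_well_le:
  assumes "\<bar>x\<bar> \<le> m - 1" "\<bar>y\<bar> \<le> m - 1"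
  shows "box_well m x y \<le> - 1"
proof -
  have block: "quadrant_block p q \<le> - 1" if "1 \<le> p" "1 \<le> q" for p q
    using mult_mono[of 1 p 1 q] that by (simp add: quadrant_block_def)
  have "1 \<le> m - x" "1 \<le> m - y" "1 \<le> m + x" "1 \<le> m + y" using assms by linarith+
  then show ?thesis by (simp add: box_well_def block)
qed

subsection \<open>Dips\<close>

text \<open>A dip of depth \<open>1/4\<close> at unit scale which costs only linear growth in \<open>\<bar>x - y\<bar>\<close>. Every axis-parallel line
  meeting the open square leaves it where the maximum is attained by the first term, so the case distinction
  does not destroy convexity.\<close>

definition dip :: "real \<Rightarrow> real \<Rightarrow> real" where
  "dip x y = (if \<bar>x\<bar> < 1 \<and> \<bar>y\<bar> < 1 then max (\<bar>x - y\<bar> - 1/4) (- (x * y)) else \<bar>x - y\<bar> - 1/4)"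

lemma neg_mult_le_abs_diff_outside:
  fixes x y :: real
  assumes "1 \<le> \<bar>x\<bar>" "\<bar>y\<bar> < 1"
  shows "- (x * y) \<le> \<bar>x - y\<bar> - 1/4"
proof (cases "0 \<le> x")
  case True
  then have "0 \<le> (x - 1) * (1 + y)" using assms by (intro mult_nonneg_nonneg) auto
  also have "\<dots> = (x - y) - (- (x * y)) - 1" by (simp add: algebra_simps)
  finally show ?thesis by linarith
next
  case False
  then have "0 \<le> (- x - 1) * (1 - y)" using assms by (intro mult_nonneg_nonneg) auto
  also have "\<dots> = (y - x) - (- (x * y)) - 1" by (simp add: algebra_simps)
  finally show ?thesis by linarith
qed

lemma sep_convex_dip: "sep_convex dip"
proof (rule sep_convex_symmetricI)
  fix y :: real
  have product: "convex_on UNIV (\<lambda>x. - (x * y))" by (intro convex_onI) (simp_all add: algebra_simps)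
  have distance: "convex_on UNIV (\<lambda>x. \<bar>x - y\<bar> - 1/4)"
    using convex_on_diff[OF convex_on_dist[of UNIV y], of "\<lambda>x. 1/4"]
    by (simp add: dist_real_def abs_minus_commute concave_on_const)
  show "convex_on UNIV (\<lambda>x. dip x y)"
  proof (cases "\<bar>y\<bar> < 1")
    case True
    then have "dip x y = max (\<bar>x - y\<bar> - 1/4) (- (x * y))" for x
      using neg_mult_le_abs_diff_outside[of x y] by (auto simp: dip_def max_def)
    then show ?thesis using convex_on_max[OF distance product] by presburger
  next
    case False
    then show ?thesis using distance by (simp add: dip_def)
  qed
qed (simp add: dip_def abs_minus_commute mult.commute)

lemma dip_le: "dip x y \<le> \<bar>x - y\<bar>"
proof -
  have "- (x * y) \<le> \<bar>x - y\<bar>" if x: "\<bar>x\<bar> < 1"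
  proof (cases "0 \<le> x * y")
    case False
    then have "\<bar>y\<bar> \<le> \<bar>x - y\<bar>" by (smt (verit) mult_nonneg_nonneg mult_nonpos_nonpos)
    moreover have "\<bar>x\<bar> * \<bar>y\<bar> \<le> 1 * \<bar>y\<bar>" using x by (intro mult_right_mono) auto
    ultimately show ?thesis using False by (simp add: abs_mult[symmetric])
  qed simp
  then show ?thesis by (auto simp: dip_def)
qed

lemma dip_ge: "- 1/4 \<le> dip x y"
  by (auto simp: dip_def max_def)

lemma dip_0: "dip 0 0 = 0"
  by (simp add: dip_def)

lemma dip_diag:
  assumes "1/2 \<le> \<bar>u\<bar>"
  shows "dip u u = - 1/4"
proof -
  have "(1/2) * (1/2) \<le> \<bar>u\<bar> * \<bar>u\<bar>" using assms by (intro mult_mono) auto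
  then show ?thesis by (simp add: dip_def max_def)
qed

lemma borel_measurable_dip: "(\<lambda>t. dip (x / t) (y / t)) \<in> borel_measurable borel"
  unfolding dip_def by measurable

lemma dip_scaled_le:
  assumes "0 \<le> t"
  shows "t * dip (x / t) (y / t) \<le> \<bar>x - y\<bar>"
proof (cases "t = 0")
  case False
  have "t * dip (x / t) (y / t) \<le> t * \<bar>x / t - y / t\<bar>" using assms by (intro mult_left_mono dip_le)
  also have "\<dots> = \<bar>x - y\<bar>" using assms False by (simp add: abs_mult flip: diff_divide_distrib)
  finally show ?thesis .
qed simp

lemma abs_dip_scaled_le:
  assumes "0 \<le> t" "t \<le> 1"
  shows "\<bar>t * dip (x / t) (y / t)\<bar> \<le> 1 + \<bar>x - y\<bar>"
proof -
  have "t * (- 1/4) \<le> t * dip (x / t) (y / t)" using assms by (intro mult_left_mono dip_ge)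
  then show ?thesis using dip_scaled_le[OF assms(1), of x y] assms by linarith
qed

definition multiscale_dip :: "(real \<Rightarrow> real) \<Rightarrow> real \<Rightarrow> real \<Rightarrow> real" where
  "multiscale_dip K x y = (LINT t:{0..1}|lborel. K t * (t * dip (x / t) (y / t)))"

lemma set_integrable_multiscale_dip:
  assumes K: "set_integrable lborel {0..1} K"
  shows "set_integrable lborel {0..1} (\<lambda>t. K t * (t * dip (x / t) (y / t)))"
proof (rule set_integrable_bound)
  show "set_integrable lborel {0..1} (\<lambda>t. K t * (1 + \<bar>x - y\<bar>))" using K by simp
  have [measurable]: "(\<lambda>t. indicat_real {0..1} t *\<^sub>R K t) \<in> borel_measurable borel"
    using borel_measurable_integrable[OF K[unfolded set_integrable_def]] by simp
  have [measurable]: "(\<lambda>t. dip (x / t) (y / t)) \<in> borel_measurable borel" by (rule borel_measurable_dip)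
  have "(\<lambda>t. (indicat_real {0..1} t *\<^sub>R K t) * (t * dip (x / t) (y / t))) \<in> borel_measurable borel"
    by measurable
  then show "set_borel_measurable lborel {0..1} (\<lambda>t. K t * (t * dip (x / t) (y / t)))"
    by (simp add: set_borel_measurable_def mult.assoc)
  show "AE t in lborel. t \<in> {0..1} \<longrightarrow> norm (K t * (t * dip (x / t) (y / t))) \<le> norm (K t * (1 + \<bar>x - y\<bar>))"
    using abs_dip_scaled_le[of _ x y] by (auto simp: abs_mult intro!: AE_I2 mult_left_mono)
qed

lemma sep_convex_multiscale_dip:
  assumes K: "set_integrable lborel {0..1} K" "\<And>t. t \<in> {0..1} \<Longrightarrow> 0 \<le> K t"
  shows "sep_convex (multiscale_dip K)"
  unfolding multiscale_dip_def
proof (intro sep_convex_set_integral set_integrable_multiscale_dip[OF K(1)] sep_convex_cmul K(2))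
  show "sep_convex (\<lambda>x y. dip (x / t) (y / t))" for t
    using sep_convex_compose_affine[OF sep_convex_dip, of "1 / t" 0] by simp
qed auto

lemma multiscale_dip_le:
  assumes K: "set_integrable lborel {0..1} K" "\<And>t. t \<in> {0..1} \<Longrightarrow> 0 \<le> K t"
  shows "multiscale_dip K x y \<le> (LINT t:{0..1}|lborel. K t) * \<bar>x - y\<bar>"
proof -
  have "multiscale_dip K x y \<le> (LINT t:{0..1}|lborel. K t * \<bar>x - y\<bar>)"
    unfolding multiscale_dip_def using K
    by (intro set_integral_mono set_integrable_multiscale_dip mult_left_mono dip_scaled_le) auto
  then show ?thesis by simp
qed

lemma multiscale_dip_0: "multiscale_dip K 0 0 = 0"
  by (simp add: multiscale_dip_def dip_0)

lemma multiscale_dip_diag_le: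
  assumes K: "set_integrable lborel {0..1} K" "\<And>t. t \<in> {0..1} \<Longrightarrow> 0 \<le> K t"
    and v: "v \<noteq> 0" "\<bar>v\<bar> \<le> 1/2"
    and \<delta>: "0 \<le> \<delta>" "\<And>t. \<bar>v\<bar> \<le> t \<Longrightarrow> t \<le> 2 * \<bar>v\<bar> \<Longrightarrow> \<delta> / t\<^sup>2 \<le> K t"
  shows "multiscale_dip K v v \<le> - \<delta> / 8"
proof -
  let ?I = "{\<bar>v\<bar>..2 * \<bar>v\<bar>}"
  have restrict: "(\<lambda>t. indicat_real {0..1} t *\<^sub>R indicat_real ?I t) = indicat_real ?I"
    using v by (auto simp: indicator_def)
  have "multiscale_dip K v v \<le> (LINT t:{0..1}|lborel. - \<delta> / (8 * \<bar>v\<bar>) * indicat_real ?I t)"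
    unfolding multiscale_dip_def
  proof (rule set_integral_mono[OF set_integrable_multiscale_dip[OF K(1)]])
    show "set_integrable lborel {0..1} (\<lambda>t. - \<delta> / (8 * \<bar>v\<bar>) * indicat_real ?I t)"
      by (intro set_integrable_mult_right) (simp add: set_integrable_def restrict del: real_scaleR_def)
    fix t :: real assume t: "t \<in> {0..1}"
    show "K t * (t * dip (v / t) (v / t)) \<le> - \<delta> / (8 * \<bar>v\<bar>) * indicat_real ?I t"
    proof (cases "t \<in> ?I")
      case True
      then have t_pos: "0 < t" using v by auto
      have "\<delta> / (8 * \<bar>v\<bar>) \<le> \<delta> / (4 * t)" using True v t_pos \<delta>(1) by (intro divide_left_mono) auto
      also have "\<dots> = \<delta> / t\<^sup>2 * (t / 4)" using t_pos by (simp add: power2_eq_square)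
      also have "\<dots> \<le> K t * (t / 4)" using True t_pos by (intro mult_right_mono \<delta>(2)) auto
      finally have "K t * (t * (- 1/4)) \<le> - \<delta> / (8 * \<bar>v\<bar>)" by simp
      moreover have "dip (v / t) (v / t) = - 1/4" using True t_pos by (intro dip_diag) (simp add: field_simps)
      ultimately show ?thesis using True by simp
    next
      case False
      then show ?thesis
        using t K(2) dip_scaled_le[of t v v] by (simp add: mult_nonneg_nonpos)
    qed
  qed
  also have "\<dots> = - \<delta> / (8 * \<bar>v\<bar>) * (LINT t:{0..1}|lborel. indicat_real ?I t)" by (rule set_integral_mult_right)
  also have "(LINT t:{0..1}|lborel. indicat_real ?I t) = \<bar>v\<bar>"
    by (simp add: set_lebesgue_integral_def restrict del: real_scaleR_def)
  finally show ?thesis using v by simp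
qed

subsection \<open>Extension of a concave function\<close>

lemma supergradient_gap_majorant:
  fixes g c :: "real \<Rightarrow> real"
  assumes g: "concave_on UNIV g" and c: "\<And>a u. g u \<le> g a + c a * (u - a)"
  obtains d :: "nat \<Rightarrow> real" where "\<And>n. 0 \<le> d n"
    and "\<And>n a u. \<bar>a\<bar> \<le> r \<Longrightarrow> \<bar>u - a\<bar> \<le> real n + 2 \<Longrightarrow> g a + c a * (u - a) - g u \<le> d n"
proof -
  have "\<exists>B\<ge>0. \<forall>a u. \<bar>a\<bar> \<le> r \<longrightarrow> \<bar>u - a\<bar> \<le> real n + 2 \<longrightarrow> g a + c a * (u - a) - g u \<le> B" for n
  proof -
    obtain B where B: "\<And>a u. \<bar>a\<bar> \<le> r + (real n + 2) \<Longrightarrow> \<bar>u\<bar> \<le> r + (real n + 2)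
        \<Longrightarrow> g a + c a * (u - a) - g u \<le> B"
      using supergradient_gap_locally_bounded[OF g c] by blast
    have "g a + c a * (u - a) - g u \<le> max 0 B" if "\<bar>a\<bar> \<le> r" "\<bar>u - a\<bar> \<le> real n + 2" for a u
      using B[of a u] that by linarith
    then show ?thesis by (intro exI[of _ "max 0 B"]) auto
  qed
  then show ?thesis using that by metis
qed

lemma nn_integral_second_difference_quotient:
  "(\<integral>\<^sup>+ t. ennreal (indicat_real A t *\<^sub>R second_difference_quotient g a t) \<partial>lborel) = second_difference_energy g a A"
  unfolding second_difference_energy_def by (intro nn_integral_cong) (simp add: indicator_def)

lemma set_integrable_second_difference_quotient:
  assumes g: "concave_on UNIV g" and finite: "second_difference_energy g a {0..1} < \<infinity>"
  shows "set_integrable lborel {0..1} (second_difference_quotient g a)"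
  unfolding set_integrable_def
proof (rule integrableI_nonneg)
  show "(\<lambda>t. indicat_real {0..1} t *\<^sub>R second_difference_quotient g a t) \<in> borel_measurable lborel"
    using borel_measurable_second_difference_quotient[OF g] by measurable
  show "(\<integral>\<^sup>+ t. ennreal (indicat_real {0..1} t *\<^sub>R second_difference_quotient g a t) \<partial>lborel) < \<infinity>"
    using finite by (simp only: nn_integral_second_difference_quotient)
qed (simp add: second_difference_quotient_nonneg[OF g])

lemma set_integral_second_difference_quotient_le:
  assumes g: "concave_on UNIV g" and M: "0 \<le> M" "second_difference_energy g a {0..1} \<le> ennreal M"
  shows "(LINT t:{0..1}|lborel. second_difference_quotient g a t) \<le> M"
  unfolding set_lebesgue_integral_def
proof (rule integral_real_bounded[OF M(1)])
  show "(\<integral>\<^sup>+ t. ennreal (indicat_real {0..1} t *\<^sub>R second_difference_quotient g a t) \<partial>lborel) \<le> ennreal M"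
    using M(2) by (simp only: nn_integral_second_difference_quotient)
qed

lemma tangent_add_multiscale_dip_le:
  assumes g: "concave_on UNIV g" and finite: "second_difference_energy g a {0..1} < \<infinity>"
    and c: "\<And>u. g u \<le> g a + c * (u - a)" and u: "\<bar>u - a\<bar> \<le> 1/2"
  shows "g a + c * (u - a) + 8 * multiscale_dip (second_difference_quotient g a) (u - a) (u - a) \<le> g u"
proof (cases "u = a")
  case True
  then show ?thesis by (simp add: multiscale_dip_0)
next
  case False
  let ?K = "second_difference_quotient g a"
  have "multiscale_dip ?K (u - a) (u - a) \<le> - second_difference g a (u - a) / 8"
  proof (rule multiscale_dip_diag_le)
    show "set_integrable lborel {0..1} ?K" by (rule set_integrable_second_difference_quotient[OF g finite])
    show "second_difference g a (u - a) / t\<^sup>2 \<le> ?K t" if "\<bar>u - a\<bar> \<le> t" for t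
      using second_difference_mono[OF g, of "\<bar>u - a\<bar>" t a] that
      by (simp add: second_difference_quotient_def second_difference_abs divide_right_mono)
  qed (use False u second_difference_nonneg[OF g] second_difference_quotient_nonneg[OF g] in auto)
  moreover have "g (a - (u - a)) \<le> g a - c * (u - a)" using c[of "a - (u - a)"] by (simp add: algebra_simps)
  ultimately show ?thesis unfolding second_difference_def by simp
qed

definition contact_function :: "(real \<Rightarrow> real) \<Rightarrow> real \<Rightarrow> (nat \<Rightarrow> real) \<Rightarrow> real \<Rightarrow> real \<Rightarrow> real \<Rightarrow> real" where
  "contact_function g c d a x y = g a + c * ((x + y) / 2 - a)
     + 8 * multiscale_dip (second_difference_quotient g a) (x - a) (y - a)
     + quadrant_series d (x - a) (y - a) + quadrant_series d (a - x) (a - y)"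

lemma sep_convex_contact_function:
  assumes g: "concave_on UNIV g" and finite: "second_difference_energy g a {0..1} < \<infinity>" and d: "\<And>n. 0 \<le> d n"
  shows "sep_convex (contact_function g c d a)"
proof -
  let ?K = "second_difference_quotient g a"
  have "sep_convex (\<lambda>x y. g a + c * ((x + y) / 2 - a))"
    using sep_convex_affine[of "g a - c * a" "c / 2" "c / 2"] by (simp add: field_simps)
  moreover have "sep_convex (multiscale_dip ?K)"
    using set_integrable_second_difference_quotient[OF g finite] second_difference_quotient_nonneg[OF g]
    by (rule sep_convex_multiscale_dip)
  then have "sep_convex (\<lambda>x y. 8 * multiscale_dip ?K (x - a) (y - a))"
    using sep_convex_compose_affine[of _ 1 "- a"] by (intro sep_convex_cmul) auto
  moreover have "sep_convex (\<lambda>x y. quadrant_series d (x - a) (y - a))"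
    using sep_convex_compose_affine[OF sep_convex_quadrant_series[of d], of 1 "- a"] d by simp
  moreover have "sep_convex (\<lambda>x y. quadrant_series d (a - x) (a - y))"
    using sep_convex_compose_affine[OF sep_convex_quadrant_series[of d], of "- 1" a] d by simp
  ultimately show ?thesis by (simp only: contact_function_def[abs_def] sep_convex_add)
qed

lemma contact_function_touches: "contact_function g c d a a a = g a"
  by (simp add: contact_function_def multiscale_dip_0 quadrant_series_0)

lemma contact_function_diag_le:
  assumes g: "concave_on UNIV g" and finite: "second_difference_energy g a {0..1} < \<infinity>" and d: "\<And>n. 0 \<le> d n"
    and c: "\<And>u. g u \<le> g a + c * (u - a)"
    and gap: "\<And>n u. \<bar>u - a\<bar> \<le> real n + 2 \<Longrightarrow> g a + c * (u - a) - g u \<le> d n / 4"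
  shows "contact_function g c d a u u \<le> g u"
proof -
  let ?K = "second_difference_quotient g a"
  have contact: "contact_function g c d a u u = g a + c * (u - a) + 8 * multiscale_dip ?K (u - a) (u - a)
      + quadrant_series d (u - a) (u - a) + quadrant_series d (a - u) (a - u)"
    by (simp add: contact_function_def)
  have dip_nonpos: "multiscale_dip ?K (u - a) (u - a) \<le> 0"
    using multiscale_dip_le[OF set_integrable_second_difference_quotient[OF g finite]
        second_difference_quotient_nonneg[OF g], of "u - a" "u - a"] by simp
  have tail_nonpos: "quadrant_series d v v \<le> 0" for v by (rule quadrant_series_diag_nonpos[OF d])
  have tail_le: "quadrant_series d v v \<le> - (g a + c * (u - a) - g u)" if v: "1/2 \<le> v" "v = \<bar>u - a\<bar>" for v
  proof -
    obtain n where "v \<le> real n + 2" "quadrant_series d v v \<le> - d n / 4"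
      by (rule quadrant_series_diag_le_neg[OF d v(1)]) (rule that)
    then show ?thesis using gap[of u n] v(2) by simp
  qed
  consider (near) "\<bar>u - a\<bar> \<le> 1/2" | (right) "1/2 \<le> u - a" | (left) "1/2 \<le> a - u" by linarith
  then show ?thesis
  proof cases
    case near
    then show ?thesis
      using tangent_add_multiscale_dip_le[OF g finite c near] tail_nonpos[of "u - a"] tail_nonpos[of "a - u"]
      unfolding contact by linarith
  next
    case right
    then have "quadrant_series d (u - a) (u - a) \<le> - (g a + c * (u - a) - g u)" by (intro tail_le) auto
    then show ?thesis using dip_nonpos tail_nonpos[of "a - u"] unfolding contact by linarith
  next
    case left
    then have "quadrant_series d (a - u) (a - u) \<le> - (g a + c * (u - a) - g u)" by (intro tail_le) auto
    then show ?thesis using dip_nonpos tail_nonpos[of "u - a"] unfolding contact by linarith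
  qed
qed

lemma contact_function_le:
  assumes g: "concave_on UNIV g" and M: "0 \<le> M" "second_difference_energy g a {0..1} \<le> ennreal M"
  shows "contact_function g c d a x y \<le> g a + c * ((x + y) / 2 - a) + 8 * M * \<bar>x - y\<bar>
           + quadrant_series d (x - a) (y - a) + quadrant_series d (a - x) (a - y)"
proof -
  let ?K = "second_difference_quotient g a"
  have "second_difference_energy g a {0..1} < \<infinity>" using M(2) by (simp add: le_less_trans)
  then have "multiscale_dip ?K (x - a) (y - a) \<le> (LINT t:{0..1}|lborel. ?K t) * \<bar>(x - a) - (y - a)\<bar>"
    by (intro multiscale_dip_le set_integrable_second_difference_quotient second_difference_quotient_nonneg g)
  also have "\<dots> \<le> M * \<bar>(x - a) - (y - a)\<bar>"
    by (intro mult_right_mono set_integral_second_difference_quotient_le[OF g M]) simp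
  finally show ?thesis by (simp add: contact_function_def)
qed

lemma contact_functions_bdd_above:
  assumes g: "concave_on UNIV g"
    and M: "0 \<le> M" "\<And>a. \<bar>a\<bar> \<le> r \<Longrightarrow> second_difference_energy g a {0..1} \<le> ennreal M"
    and d: "\<And>n. 0 \<le> d n" and c: "\<And>a u. g u \<le> g a + c a * (u - a)"
  shows "bdd_above ((\<lambda>a. contact_function g (c a) d a x y) ` {- r..r})"
proof -
  define m where "m = (x + y) / 2"
  obtain B where B: "\<And>a u. \<bar>a\<bar> \<le> max r \<bar>m\<bar> \<Longrightarrow> \<bar>u\<bar> \<le> max r \<bar>m\<bar> \<Longrightarrow> g a + c a * (u - a) - g u \<le> B"
    using supergradient_gap_locally_bounded[OF g c] by blast
  obtain C where C: "\<And>x' y'. \<bar>x'\<bar> \<le> max \<bar>x\<bar> \<bar>y\<bar> + r \<Longrightarrow> \<bar>y'\<bar> \<le> max \<bar>x\<bar> \<bar>y\<bar> + r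
      \<Longrightarrow> quadrant_series d x' y' \<le> C"
    by (rule sep_convex_bounded_above_on_box[OF sep_convex_quadrant_series[OF d]]) (rule that)
  have "contact_function g (c a) d a x y \<le> g m + B + 8 * M * \<bar>x - y\<bar> + C + C" if "a \<in> {- r..r}" for a
  proof -
    have a: "\<bar>a\<bar> \<le> r" using that by auto
    have "g a + c a * (m - a) \<le> g m + B" using B[of a m] a by (simp add: max.coboundedI1)
    moreover have "quadrant_series d (x - a) (y - a) \<le> C" "quadrant_series d (a - x) (a - y) \<le> C"
      using a by (auto intro!: C)
    ultimately show ?thesis
      using contact_function_le[OF g M(1) M(2)[OF a], of "c a" d x y] unfolding m_def by linarith
  qed
  then show ?thesis by (rule bdd_aboveI2)
qed

lemma local_trace_of_energy_bounded:
  assumes g: "concave_on UNIV g" and r: "0 \<le> r"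
    and M: "0 \<le> M" "\<And>a. \<bar>a\<bar> \<le> r \<Longrightarrow> second_difference_energy g a {0..1} \<le> ennreal M"
  shows "\<exists>f. sep_convex f \<and> (\<forall>u. f u u \<le> g u) \<and> (\<forall>u. \<bar>u\<bar> \<le> r \<longrightarrow> f u u = g u)"
proof -
  have "\<exists>c. \<forall>u. g u \<le> g a + c * (u - a)" for a
    using concave_on_supergradient[OF g] by metis
  then obtain c where c: "\<And>a u. g u \<le> g a + c a * (u - a)" by metis
  obtain d where d: "\<And>n. 0 \<le> d n"
    and gap: "\<And>n a u. \<bar>a\<bar> \<le> r \<Longrightarrow> \<bar>u - a\<bar> \<le> real n + 2 \<Longrightarrow> g a + c a * (u - a) - g u \<le> d n"
    using supergradient_gap_majorant[OF g c] by metis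
  define \<phi> where "\<phi> a = contact_function g (c a) (\<lambda>n. 4 * d n) a" for a
  have finite: "second_difference_energy g a {0..1} < \<infinity>" if "\<bar>a\<bar> \<le> r" for a
    using M(2)[OF that] by (simp add: le_less_trans)
  have \<phi>: "sep_convex (\<phi> a)" if "\<bar>a\<bar> \<le> r" for a
    unfolding \<phi>_def using d by (intro sep_convex_contact_function[OF g finite[OF that]]) simp
  have \<phi>_diag_le: "\<phi> a u u \<le> g u" if "\<bar>a\<bar> \<le> r" for a u
    unfolding \<phi>_def using d gap[OF that] by (intro contact_function_diag_le[OF g finite[OF that] _ c]) simp_all
  have bdd: "bdd_above ((\<lambda>a. \<phi> a x y) ` {- r..r})" for x y
    unfolding \<phi>_def using d by (intro contact_functions_bdd_above[OF g M _ c]) simp_all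
  define f where "f x y = (SUP a\<in>{- r..r}. \<phi> a x y)" for x y
  have "sep_convex f"
    unfolding f_def[abs_def] using r by (intro sep_convex_SUP \<phi> bdd) auto
  moreover have f_le: "f u u \<le> g u" for u
    unfolding f_def using r by (intro cSUP_least \<phi>_diag_le) auto
  moreover have "f u u = g u" if "\<bar>u\<bar> \<le> r" for u
  proof (rule antisym[OF f_le])
    have "\<phi> u u u \<le> f u u" unfolding f_def using that by (intro cSUP_upper bdd) auto
    then show "g u \<le> f u u" by (simp add: \<phi>_def contact_function_touches)
  qed
  ultimately show ?thesis by blast
qed

lemma sep_convex_lower_on_box:
  assumes f: "sep_convex f"
  obtains h where "sep_convex h" "\<And>u. h u u \<le> f u u" "\<And>u. m \<le> \<bar>u\<bar> \<Longrightarrow> h u u = f u u"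
    and "\<And>x y. \<bar>x\<bar> \<le> m - 1 \<Longrightarrow> \<bar>y\<bar> \<le> m - 1 \<Longrightarrow> h x y \<le> 0"
proof -
  obtain B where B: "\<And>x y. \<bar>x\<bar> \<le> m - 1 \<Longrightarrow> \<bar>y\<bar> \<le> m - 1 \<Longrightarrow> f x y \<le> B"
    using sep_convex_bounded_above_on_box[OF f] by blast
  define h where "h x y = f x y + max 0 B * box_well m x y" for x y
  show ?thesis
  proof
    show "sep_convex h"
      unfolding h_def[abs_def] by (intro sep_convex_add sep_convex_cmul sep_convex_box_well f) simp
    show "h u u \<le> f u u" for u
      using mult_nonneg_nonpos[of "max 0 B", OF _ box_well_diag_nonpos] by (simp add: h_def)
    show "h u u = f u u" if "m \<le> \<bar>u\<bar>" for u
      using that by (simp add: h_def box_well_diag_eq_0)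
    show "h x y \<le> 0" if "\<bar>x\<bar> \<le> m - 1" "\<bar>y\<bar> \<le> m - 1" for x y
    proof -
      have "max 0 B * box_well m x y \<le> max 0 B * - 1" by (intro mult_left_mono box_well_le that) simp
      then show ?thesis using B[OF that] by (simp add: h_def)
    qed
  qed
qed

lemma trace_of_local_traces:
  assumes local: "\<And>n. \<exists>f. sep_convex f \<and> (\<forall>u. f u u \<le> g u) \<and> (\<forall>u. \<bar>u\<bar> \<le> real n \<longrightarrow> f u u = g u)"
  obtains f where "sep_convex f" "\<And>u. f u u = g u"
proof -
  have "\<exists>h. sep_convex h \<and> (\<forall>u. h u u \<le> g u) \<and> (\<forall>u. real n - 1 \<le> \<bar>u\<bar> \<longrightarrow> \<bar>u\<bar> \<le> real n \<longrightarrow> h u u = g u)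
      \<and> (\<forall>x y. \<bar>x\<bar> \<le> real n - 2 \<longrightarrow> \<bar>y\<bar> \<le> real n - 2 \<longrightarrow> h x y \<le> 0)" for n
  proof -
    obtain f where f: "sep_convex f" "\<And>u. f u u \<le> g u" "\<And>u. \<bar>u\<bar> \<le> real n \<Longrightarrow> f u u = g u"
      using local by blast
    obtain h where h: "sep_convex h" "\<And>u. h u u \<le> f u u" "\<And>u. real n - 1 \<le> \<bar>u\<bar> \<Longrightarrow> h u u = f u u"
      "\<And>x y. \<bar>x\<bar> \<le> real n - 1 - 1 \<Longrightarrow> \<bar>y\<bar> \<le> real n - 1 - 1 \<Longrightarrow> h x y \<le> 0"
      by (rule sep_convex_lower_on_box[OF f(1)]) (rule that)
    have "h u u \<le> g u" for u using h(2) f(2) by (rule order_trans)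
    then show ?thesis using h f(3) by (intro exI[of _ h]) auto
  qed
  then obtain h where h: "\<And>n. sep_convex (h n)" and h_diag_le: "\<And>n u. h n u u \<le> g u"
    and h_diag: "\<And>n u. real n - 1 \<le> \<bar>u\<bar> \<Longrightarrow> \<bar>u\<bar> \<le> real n \<Longrightarrow> h n u u = g u"
    and h_nonpos: "\<And>n x y. \<bar>x\<bar> \<le> real n - 2 \<Longrightarrow> \<bar>y\<bar> \<le> real n - 2 \<Longrightarrow> h n x y \<le> 0"
    by metis
  have bdd: "bdd_above (range (\<lambda>n. h n x y))" for x y
  proof -
    obtain N :: nat where N: "max \<bar>x\<bar> \<bar>y\<bar> + 2 \<le> real N" using real_arch_simple by blast
    have "h n x y \<le> 0" if "N \<le> n" for n using N that by (intro h_nonpos) auto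
    then have "h n x y \<in> (\<lambda>n. h n x y) ` {..<N} \<union> {..0}" for n by (cases "n < N") auto
    then have "range (\<lambda>n. h n x y) \<subseteq> (\<lambda>n. h n x y) ` {..<N} \<union> {..0}" by blast
    then show ?thesis by (rule bdd_above_mono[rotated]) auto
  qed
  have "(SUP n. h n u u) = g u" for u
  proof (rule antisym)
    show "(SUP n. h n u u) \<le> g u" by (intro cSUP_least h_diag_le) auto
    have "h (nat \<lceil>\<bar>u\<bar>\<rceil>) u u = g u" by (rule h_diag) linarith+
    then show "g u \<le> (SUP n. h n u u)" using cSUP_upper[OF UNIV_I bdd] by metis
  qed
  moreover have "sep_convex (\<lambda>x y. SUP n. h n x y)" by (intro sep_convex_SUP h bdd) auto
  ultimately show ?thesis using that by blast
qed

proposition trace_of_energy_locally_bounded: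
  assumes g: "concave_on UNIV g"
    and energy: "\<And>S. bounded S \<Longrightarrow> \<exists>M. \<forall>a\<in>S. second_difference_energy g a {0..1} \<le> ennreal M"
  shows "\<exists>f. sep_convex f \<and> (\<forall>u. f u u = g u)"
proof -
  have "\<exists>f. sep_convex f \<and> (\<forall>u. f u u \<le> g u) \<and> (\<forall>u. \<bar>u\<bar> \<le> real n \<longrightarrow> f u u = g u)" for n
  proof -
    obtain M where M: "\<forall>a\<in>cball 0 (real n). second_difference_energy g a {0..1} \<le> ennreal M"
      using energy bounded_cball by blast
    have "second_difference_energy g a {0..1} \<le> ennreal (max 0 M)" if "\<bar>a\<bar> \<le> real n" for a
      using M that by (intro order_trans[OF _ ennreal_leI[of M "max 0 M"]]) auto
    then show ?thesis by (intro local_trace_of_energy_bounded[OF g, of _ "max 0 M"]) auto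
  qed
  then show ?thesis using trace_of_local_traces by blast
qed

theorem theorem1p1:
  fixes g :: "real \<Rightarrow> real"
  assumes "concave_on UNIV g"
  shows "(\<exists>f :: real \<Rightarrow> real \<Rightarrow> real. sep_convex f \<and> (\<forall>u. f u u = g u))
     \<longleftrightarrow> (\<forall>S :: real set. bounded S \<longrightarrow>
            (\<exists>M :: real. \<forall>x\<in>S. ereal M \<le> second_diff_integral g x))"
  unfolding second_diff_integral_bounded_below_iff
proof
  assume "\<exists>f. sep_convex f \<and> (\<forall>u. f u u = g u)"
  then obtain f where f: "sep_convex f" "(\<lambda>u. f u u) = g" by auto
  then show "\<forall>S. bounded S \<longrightarrow> (\<exists>M. \<forall>a\<in>S. second_difference_energy g a {0..1} \<le> ennreal M)"
    using energy_of_trace_locally_bounded[OF f(1)] assms by simp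
next
  assume "\<forall>S. bounded S \<longrightarrow> (\<exists>M. \<forall>a\<in>S. second_difference_energy g a {0..1} \<le> ennreal M)"
  then show "\<exists>f. sep_convex f \<and> (\<forall>u. f u u = g u)"
    by (intro trace_of_energy_locally_bounded[OF assms]) blast
qed

end
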